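(* Let $0\le r_m\le r_p\le\sqrt{2}$ and let $P_{\mathbf{X}^\star}$ be the capacity-achieving input distribution for $\mathsf{C}(r_p,r_m)$. Then $$\mathrm{supp}(P_{\mathbf{X}^\star})\subseteq \partial\mathcal{E}(r_p,r_m),$$ where $\partial\mathcal{E}(r_p,r_m)$ is the boundary of $\mathcal{E}(r_p,r_m)$.
   Context: For $r_p\ge r_m\ge 0$, $\mathcal{E}(r_p,r_m)=\{(x_1,x_2)\in\mathbb{R}^2: x_1^2/r_p^2+x_2^2/r_m^2\le 1\}$ (a zero radius forces the corresponding coordinate to be $0$). Let $\mathbf{Z}$ be a standard normal vector in $\mathbb{R}^2$ independent of $\mathbf{X}$, and $\mathsf{C}(r_p,r_m)=\max_{P_{\mathbf{X}}:\,\mathbf{X}\in\mathcal{E}(r_p,r_m)\text{ a.s.}} I(\mathbf{X};\mathbf{X}+\mathbf{Z})$, where $I$ is mutual information. The maximizing (capacity-achieving) distribution $P_{\mathbf{X}^\star}$ exists and is unique. $\mathrm{supp}(P_{\mathbf{X}})$ is the set of $\mathbf{x}$ such that $P_{\mathbf{X}}(\mathcal{D})>0$ for every open set $\mathcal{D}\ni\mathbf{x}$. *)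

theory Defs
  imports "HOL-Probability.Probability"
begin

text \<open>Division by zero yields \<open>0\<close>, so a vanishing radius contributes nothing to the sum; the two
  implications then force the corresponding coordinate to be \<open>0\<close>.\<close>

definition ellipse :: "real \<Rightarrow> real \<Rightarrow> (real \<times> real) set" where
  "ellipse rp rm = {(x1, x2). x1\<^sup>2 / rp\<^sup>2 + x2\<^sup>2 / rm\<^sup>2 \<le> 1 \<and>
     (rp = 0 \<longrightarrow> x1 = 0) \<and> (rm = 0 \<longrightarrow> x2 = 0)}"

definition std_normal2 :: "(real \<times> real) measure" where
  "std_normal2 = density lborel std_normal_density \<Otimes>\<^sub>M density lborel std_normal_density"

definition input_distributions :: "real \<Rightarrow> real \<Rightarrow> (real \<times> real) measure set" where
  "input_distributions rp rm =
     {P. prob_space P \<and> sets P = sets borel \<and> (AE x in P. x \<in> ellipse rp rm)}"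

text \<open>\<open>I(X; X + Z)\<close> in nats for \<open>X\<close> distributed as \<open>P\<close>; the product measure \<open>P \<Otimes>\<^sub>M std_normal2\<close> makes
  the two projections \<open>X\<close> and \<open>Z\<close> independent.\<close>

definition gaussian_mutual_information :: "(real \<times> real) measure \<Rightarrow> real" where
  "gaussian_mutual_information P =
     prob_space.mutual_information (P \<Otimes>\<^sub>M std_normal2) (exp 1) borel borel
       (\<lambda>(x, z). x) (\<lambda>(x, z). x + z)"

text \<open>The supremum is taken in the extended reals, so it is meaningful without a prior proof that
  the mutual informations are bounded.\<close>

definition capacity :: "real \<Rightarrow> real \<Rightarrow> ereal" where
  "capacity rp rm = (SUP P\<in>input_distributions rp rm. ereal (gaussian_mutual_information P))"

definition capacity_achieving :: "real \<Rightarrow> real \<Rightarrow> (real \<times> real) measure \<Rightarrow> bool" where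
  "capacity_achieving rp rm P \<longleftrightarrow>
     P \<in> input_distributions rp rm \<and> ereal (gaussian_mutual_information P) = capacity rp rm"

definition measure_supp :: "'a::topological_space measure \<Rightarrow> 'a set" where
  "measure_supp P = {x. \<forall>D. open D \<and> x \<in> D \<longrightarrow> emeasure P D > 0}"

end

theory Submission
  imports Defs
begin

text \<open>
  Let \<open>f\<close> be the density of \<open>Y = X + Z\<close> and \<open>i(x) = E[- ln f(x + Z)]\<close>, so that
  \<open>I(X; X + Z) = E[i(X)] - h(Z)\<close>. Contaminating an optimal input with a small point mass at \<open>q\<close>
  and using Gibbs' inequality shows \<open>i(q) \<le> E[i(X)]\<close> for every \<open>q\<close> in the ellipse.
  Moreover \<open>- ln f\<close> is subharmonic: its Laplacian at \<open>y\<close> is \<open>2\<close> minus the trace of the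
  covariance of \<open>X\<close> given \<open>Y = y\<close>, which is nonnegative as \<open>\<bar>X\<bar>\<^sup>2 \<le> 2\<close>. A strict, derivative-free version
  compares \<open>- ln f(y)\<close> with its mean over the four points at distance \<open>d\<close> along the axes, and
  reduces to \<open>cosh a + cosh b < 2 exp (d\<^sup>2 / 2)\<close> for \<open>a\<^sup>2 + b\<^sup>2 \<le> 2 d\<^sup>2\<close>. Hence \<open>i < E[i(X)]\<close> in the
  interior of the ellipse, which therefore carries no mass.
\<close>

section \<open>The planar Gaussian density\<close>

definition gauss2 :: "real \<times> real \<Rightarrow> real" where
  "gauss2 z = std_normal_density (fst z) * std_normal_density (snd z)"

lemma norm_prod_power2: "(norm (z :: real \<times> real))\<^sup>2 = (fst z)\<^sup>2 + (snd z)\<^sup>2"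
  by (simp add: norm_prod_def)

lemma gauss2_eq: "gauss2 z = exp (- (norm z)\<^sup>2 / 2) / (2 * pi)"
  unfolding gauss2_def norm_prod_power2 std_normal_density_def
  by (simp add: exp_add[symmetric] field_simps flip: real_sqrt_mult power2_eq_square)

lemma gauss2_pos: "0 < gauss2 z"
  by (simp add: gauss2_eq)

lemma gauss2_le: "gauss2 z \<le> 1 / (2 * pi)"
  unfolding gauss2_eq by (intro divide_right_mono) auto

lemma borel_measurable_gauss2 [measurable]: "gauss2 \<in> borel_measurable borel"
  unfolding gauss2_eq[abs_def] by measurable

lemma norm_add_power2_le:
  fixes x y :: "'a :: real_inner"
  shows "(norm (x + y))\<^sup>2 \<le> 2 * (norm x)\<^sup>2 + 2 * (norm y)\<^sup>2"
proof -
  have "0 \<le> (norm (x - y))\<^sup>2" by simp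
  then show ?thesis
    by (simp add: power2_norm_eq_inner algebra_simps inner_commute)
qed

text \<open>By \<open>norm_add_power2_le\<close>, |y - x|^2 <= 2 |y|^2 + 4. The bound does not
  depend on \<open>x\<close>, so it survives averaging over the input.\<close>

lemma gauss2_diff_ge:
  assumes "(norm x)\<^sup>2 \<le> 2"
  shows "exp (- (norm y)\<^sup>2 - 2) / (2 * pi) \<le> gauss2 (y - x)"
  unfolding gauss2_eq using norm_add_power2_le[of y "- x"] assms
  by (intro divide_right_mono) auto

lemma std_normal2_eq_density: "std_normal2 = density lborel gauss2"
proof -
  have "std_normal2 = density (lborel \<Otimes>\<^sub>M lborel)
      (\<lambda>(x, y). ennreal (std_normal_density x) * ennreal (std_normal_density y))"
    unfolding std_normal2_def
    by (rule pair_measure_density)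
       (auto intro: sigma_finite_lborel
          prob_space_imp_sigma_finite[OF prob_space_normal_density[where \<mu>=0 and \<sigma>=1, simplified]])
  also have "(\<lambda>(x, y). ennreal (std_normal_density x) * ennreal (std_normal_density y))
      = (\<lambda>z. ennreal (gauss2 z))"
    by (auto simp: gauss2_def ennreal_mult)
  finally show ?thesis by (simp add: lborel_prod)
qed

lemma sets_std_normal2 [measurable_cong, simp]: "sets std_normal2 = sets borel"
  by (simp add: std_normal2_eq_density)

lemma space_std_normal2 [simp]: "space std_normal2 = UNIV"
  by (simp add: std_normal2_eq_density)

section \<open>Second moments and translates of the Gaussian noise\<close>

lemma integrable_pair_fst_plus_snd:
  fixes f :: "'a \<Rightarrow> real" and g :: "'b \<Rightarrow> real"
  assumes "prob_space A" "prob_space B" and f: "integrable A f" and g: "integrable B g"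
  shows "integrable (A \<Otimes>\<^sub>M B) (\<lambda>z. f (fst z) + g (snd z))"
proof -
  interpret A: prob_space A by fact
  interpret B: prob_space B by fact
  interpret pair_prob_space A B ..
  have "integrable (A \<Otimes>\<^sub>M B) (\<lambda>z. f (fst z))"
    using f B.distr_pair_fst[of A] integrable_distr_eq[of fst "A \<Otimes>\<^sub>M B" A f] by simp
  moreover have "integrable (B \<Otimes>\<^sub>M A) (\<lambda>z. g (fst z))"
    using g A.distr_pair_fst[of B] integrable_distr_eq[of fst "B \<Otimes>\<^sub>M A" B g] by simp
  then have "integrable (A \<Otimes>\<^sub>M B) (\<lambda>z. g (snd z))"
    by (simp add: integrable_product_swap_iff[symmetric] split_beta')
  ultimately show ?thesis by simp
qed

interpretation std_normal2: prob_space std_normal2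
proof -
  interpret A: prob_space "density lborel std_normal_density"
    by (rule prob_space_normal_density) simp
  interpret pair_prob_space "density lborel std_normal_density" "density lborel std_normal_density" ..
  show "prob_space std_normal2"
    unfolding std_normal2_def by (rule prob_space_axioms)
qed


lemma integrable_std_normal2_norm_power2: "integrable std_normal2 (\<lambda>z. (norm z)\<^sup>2)"
proof -
  have p: "prob_space (density lborel std_normal_density)"
    by (rule prob_space_normal_density) simp
  have i: "integrable (density lborel std_normal_density) (\<lambda>x. x\<^sup>2)"
    by (subst integrable_real_density) (auto simp: integrable_std_normal_moment)
  show ?thesis
    unfolding norm_prod_power2 std_normal2_def by (rule integrable_pair_fst_plus_snd[OF p p i i])
qed

lemma nn_integral_std_normal2_shift:
  fixes f :: "real \<times> real \<Rightarrow> ennreal"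
  assumes [measurable]: "f \<in> borel_measurable borel"
  shows "(\<integral>\<^sup>+z. f (x + z) \<partial>std_normal2) = (\<integral>\<^sup>+y. gauss2 (y - x) * f y \<partial>lborel)"
proof -
  have "(\<integral>\<^sup>+z. f (x + z) \<partial>std_normal2) = (\<integral>\<^sup>+z. gauss2 z * f (x + z) \<partial>lborel)"
    unfolding std_normal2_eq_density by (subst nn_integral_density) auto
  also have "\<dots> = (\<integral>\<^sup>+z. gauss2 (x + z - x) * f (x + z) \<partial>lborel)"
    by simp
  also have "\<dots> = (\<integral>\<^sup>+y. gauss2 (y - x) * f y \<partial>distr lborel borel ((+) x))"
    by (subst nn_integral_distr) auto
  finally show ?thesis by (simp add: lborel_distr_plus)
qed

section \<open>Output density and surprisal of an input of bounded norm\<close>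

definition out_density :: "(real \<times> real) measure \<Rightarrow> real \<times> real \<Rightarrow> real" where
  "out_density P y = (\<integral>x. gauss2 (y - x) \<partial>P)"

definition surprisal :: "(real \<times> real) measure \<Rightarrow> real \<times> real \<Rightarrow> real" where
  "surprisal P y = - ln (out_density P y)"

text \<open>The function \<open>i\<close> of the overview: the cross-entropy of the law of
  \<open>x + Z\<close> relative to the output density.\<close>

definition cross_info :: "(real \<times> real) measure \<Rightarrow> real \<times> real \<Rightarrow> real" where
  "cross_info P x = (\<integral>z. surprisal P (x + z) \<partial>std_normal2)"

text \<open>A bound on the absolute surprisal that is the same for all inputs with |X|^2 <= 2, hence
  fit for dominated convergence while the input varies.\<close>

definition growth :: "real \<times> real \<Rightarrow> real" where
  "growth y = ln (2 * pi) + 2 + (norm y)\<^sup>2"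

lemma growth_ge_1: "1 \<le> growth y"
  using ln_ge_zero[of "2 * pi"] pi_gt3 zero_le_power2[of "norm y"]
  by (simp add: growth_def del: zero_le_power2)

lemma growth_nonneg: "0 \<le> growth y"
  using growth_ge_1[of y] by simp

lemma borel_measurable_growth [measurable]: "growth \<in> borel_measurable borel"
  unfolding growth_def[abs_def] by measurable

lemma integrable_growth_shift: "integrable std_normal2 (\<lambda>z. growth (x + z))"
proof (rule Bochner_Integration.integrable_bound)
  show "integrable std_normal2 (\<lambda>z. ln (2 * pi) + 2 + 2 * (norm x)\<^sup>2 + 2 * (norm z)\<^sup>2)"
    using integrable_std_normal2_norm_power2 by simp
  show "AE z in std_normal2. norm (growth (x + z))
      \<le> norm (ln (2 * pi) + 2 + 2 * (norm x)\<^sup>2 + 2 * (norm z)\<^sup>2)"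
  proof (rule AE_I2)
    fix z
    have "0 \<le> ln (2 * pi)" using pi_gt3 by simp
    then show "norm (growth (x + z)) \<le> norm (ln (2 * pi) + 2 + 2 * (norm x)\<^sup>2 + 2 * (norm z)\<^sup>2)"
      using norm_add_power2_le[of x z] by (simp add: growth_def)
  qed
qed (simp add: growth_def)

text \<open>Shared by the optimal input and its contaminations, so that both obey the same
  estimates; \<open>2\<close> bounds the squared norm on an ellipse with
  \<open>rp \<le> sqrt 2\<close>.\<close>

locale bounded_input = prob_space P for P :: "(real \<times> real) measure" +
  assumes sets_P [measurable_cong]: "sets P = sets borel"
    and AE_norm_le: "AE x in P. (norm x)\<^sup>2 \<le> 2"
begin

lemma space_P [simp]: "space P = UNIV"
  using sets_eq_imp_space_eq[OF sets_P] by simp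

lemma integrable_gauss2_diff: "integrable P (\<lambda>x. gauss2 (y - x))"
  by (rule integrable_const_bound[where B="1 / (2 * pi)"])
     (use gauss2_le gauss2_pos in \<open>auto simp: less_imp_le abs_of_pos\<close>)

lemma borel_measurable_out_density [measurable]: "out_density P \<in> borel_measurable borel"
  unfolding out_density_def[abs_def] by measurable

lemma borel_measurable_surprisal [measurable]: "surprisal P \<in> borel_measurable borel"
  unfolding surprisal_def[abs_def] by measurable

lemma out_density_le: "out_density P y \<le> 1 / (2 * pi)"
  unfolding out_density_def by (rule integral_le_const[OF integrable_gauss2_diff]) (simp add: gauss2_le)

lemma out_density_ge: "exp (- (norm y)\<^sup>2 - 2) / (2 * pi) \<le> out_density P y"
  unfolding out_density_def
  by (rule integral_ge_const[OF integrable_gauss2_diff])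
     (use AE_norm_le in eventually_elim, rule gauss2_diff_ge)

lemma out_density_pos: "0 < out_density P y"
  by (rule less_le_trans[OF _ out_density_ge]) simp

text \<open>The two density bounds put the surprisal between \<open>ln (2 * pi)\<close>, which is
  nonnegative, and \<open>growth y\<close>.\<close>

lemma abs_surprisal_le: "\<bar>surprisal P y\<bar> \<le> growth y"
proof -
  have "ln (exp (- (norm y)\<^sup>2 - 2) / (2 * pi)) \<le> ln (out_density P y)"
    using out_density_ge by (subst ln_le_cancel_iff) (auto simp: out_density_pos)
  moreover have "ln (out_density P y) \<le> ln (1 / (2 * pi))"
    using out_density_le by (subst ln_le_cancel_iff) (auto simp: out_density_pos)
  moreover have "0 \<le> ln (2 * pi)" using pi_gt3 by simp
  ultimately show ?thesis
    using zero_le_power2[of "norm y"]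
    unfolding surprisal_def growth_def abs_le_iff by (simp add: ln_div del: zero_le_power2 ln_ge_zero_iff)
qed

lemma integrable_surprisal_shift: "integrable std_normal2 (\<lambda>z. surprisal P (x + z))"
  by (rule Bochner_Integration.integrable_bound[OF integrable_growth_shift[of x]])
     (use abs_surprisal_le in \<open>simp_all add: growth_nonneg del: split_paired_All\<close>)

section \<open>Joint law of input and output, and expectations over the output\<close>

sublocale XZ: pair_prob_space P std_normal2 ..

text \<open>The reference measure in the first coordinate is \<open>P\<close>, because the input may
  have no Lebesgue density; given \<open>X = x\<close>, the output has density
  \<open>gauss2 (y - x)\<close>.\<close>

lemma distributed_joint:
  "distributed (P \<Otimes>\<^sub>M std_normal2) (P \<Otimes>\<^sub>M lborel) (\<lambda>(x, z). (x, x + z))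
     (\<lambda>(x, y). gauss2 (y - x))"
  unfolding distributed_def
proof (intro conjI)
  show "distr (P \<Otimes>\<^sub>M std_normal2) (P \<Otimes>\<^sub>M lborel) (\<lambda>(x, z). (x, x + z))
      = density (P \<Otimes>\<^sub>M lborel) (\<lambda>p. ennreal (case p of (x, y) \<Rightarrow> gauss2 (y - x)))" (is "?D = ?R")
  proof (rule measure_eqI)
    fix A assume "A \<in> sets ?D"
    then have [measurable]: "A \<in> sets (borel \<Otimes>\<^sub>M borel)"
      by (simp add: sets_P cong: sets_pair_measure_cong)
    have "emeasure ?D A = (\<integral>\<^sup>+p. indicator A (fst p, fst p + snd p) \<partial>(P \<Otimes>\<^sub>M std_normal2))"
      by (subst nn_integral_indicator[symmetric], simp add: sets_P cong: sets_pair_measure_cong)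
         (subst nn_integral_distr, auto simp: split_beta')
    also have "\<dots> = (\<integral>\<^sup>+x. \<integral>\<^sup>+z. indicator A (x, x + z) \<partial>std_normal2 \<partial>P)"
      by (subst std_normal2.nn_integral_fst[symmetric]) auto
    also have "\<dots> = (\<integral>\<^sup>+x. \<integral>\<^sup>+y. ennreal (gauss2 (y - x)) * indicator A (x, y) \<partial>lborel \<partial>P)"
      by (subst nn_integral_std_normal2_shift) auto
    also have "\<dots> = (\<integral>\<^sup>+p. ennreal (case p of (x, y) \<Rightarrow> gauss2 (y - x)) * indicator A p \<partial>(P \<Otimes>\<^sub>M lborel))"
      by (subst lborel.nn_integral_fst[symmetric]) auto
    also have "\<dots> = emeasure ?R A"
      by (subst emeasure_density) (auto simp: split_beta' sets_P cong: sets_pair_measure_cong)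
    finally show "emeasure ?D A = emeasure ?R A" .
  qed simp
qed auto


lemma nn_integral_gauss2_diff: "(\<integral>\<^sup>+x. gauss2 (y - x) \<partial>P) = out_density P y"
  unfolding out_density_def
  by (rule nn_integral_eq_integral[OF integrable_gauss2_diff]) (simp add: gauss2_pos less_imp_le)

lemma distributed_output:
  "distributed (P \<Otimes>\<^sub>M std_normal2) lborel (\<lambda>(x, z). x + z) (out_density P)"
proof -
  have "distributed (P \<Otimes>\<^sub>M std_normal2) lborel (\<lambda>w. fst w + snd w)
      (\<lambda>y. \<integral>\<^sup>+x. (case (x, y) of (x, y) \<Rightarrow> ennreal (gauss2 (y - x))) \<partial>P)"
    by (rule XZ.distr_marginal2[where X = fst and S = P])
       (use distributed_joint in \<open>auto simp: split_beta' sigma_finite_lborel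
          intro: prob_space_imp_sigma_finite prob_space_axioms\<close>)
  then show ?thesis
    by (simp add: split_beta' nn_integral_gauss2_diff)
qed

lemma integrable_shift_of_growth:
  assumes [measurable]: "g \<in> borel_measurable borel" and g: "\<And>y. \<bar>g y\<bar> \<le> growth y"
  shows "integrable (P \<Otimes>\<^sub>M std_normal2) (\<lambda>(x, z). g (x + z))"
proof (rule Bochner_Integration.integrable_bound)
  have "integrable P (\<lambda>x. (norm x)\<^sup>2)"
    by (rule integrable_const_bound[where B=2]) (use AE_norm_le in auto)
  then show "integrable (P \<Otimes>\<^sub>M std_normal2)
      (\<lambda>w. (ln (2 * pi) + 2 + 2 * (norm (fst w))\<^sup>2) + 2 * (norm (snd w))\<^sup>2)"
    using integrable_std_normal2_norm_power2
    by (intro integrable_pair_fst_plus_snd prob_space_axioms std_normal2.prob_space_axioms) auto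
  show "AE w in P \<Otimes>\<^sub>M std_normal2. norm (case w of (x, z) \<Rightarrow> g (x + z))
      \<le> norm ((ln (2 * pi) + 2 + 2 * (norm (fst w))\<^sup>2) + 2 * (norm (snd w))\<^sup>2)"
  proof (rule AE_I2)
    fix w :: "(real \<times> real) \<times> (real \<times> real)"
    have "\<bar>g (fst w + snd w)\<bar> \<le> (ln (2 * pi) + 2 + 2 * (norm (fst w))\<^sup>2) + 2 * (norm (snd w))\<^sup>2"
      using g[of "fst w + snd w"] norm_add_power2_le[of "fst w" "snd w"]
      by (simp add: growth_def)
    then show "norm (case w of (x, z) \<Rightarrow> g (x + z))
      \<le> norm ((ln (2 * pi) + 2 + 2 * (norm (fst w))\<^sup>2) + 2 * (norm (snd w))\<^sup>2)"
      by (simp add: split_beta')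
  qed
qed auto

text \<open>Two ways to compute E[g(Y)]: through the output density, or by integrating out first the
  noise and then the input. Gibbs' inequality uses the first form, \<open>cross_info\<close> the
  second.\<close>

lemma
  assumes g [measurable]: "g \<in> borel_measurable borel" and "\<And>y. \<bar>g y\<bar> \<le> growth y"
  shows integrable_out_density_times: "integrable lborel (\<lambda>y. out_density P y * g y)"
    and integral_out_density_times:
      "(\<integral>y. out_density P y * g y \<partial>lborel) = (\<integral>x. \<integral>z. g (x + z) \<partial>std_normal2 \<partial>P)"
    and integrable_integral_shift: "integrable P (\<lambda>x. \<integral>z. g (x + z) \<partial>std_normal2)"
proof -
  note i = integrable_shift_of_growth[OF assms]
  note d = distributed_output
  have eq: "(\<lambda>x. g (case x of (x, z) \<Rightarrow> x + z)) = (\<lambda>(x, z). g (x + z))"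
    by (simp add: fun_eq_iff)
  show "integrable lborel (\<lambda>y. out_density P y * g y)"
    using distributed_integrable[OF d, of g] i by (simp add: eq out_density_pos less_imp_le)
  have "(\<integral>y. out_density P y * g y \<partial>lborel)
      = (\<integral>w. (case w of (x, z) \<Rightarrow> g (x + z)) \<partial>(P \<Otimes>\<^sub>M std_normal2))"
    using distributed_integral[OF d, of g] by (simp add: eq out_density_pos less_imp_le)
  also have "\<dots> = (\<integral>x. \<integral>z. g (x + z) \<partial>std_normal2 \<partial>P)"
    using XZ.integral_fst'[OF i] by simp
  finally show "(\<integral>y. out_density P y * g y \<partial>lborel) = (\<integral>x. \<integral>z. g (x + z) \<partial>std_normal2 \<partial>P)" .
  show "integrable P (\<lambda>x. \<integral>z. g (x + z) \<partial>std_normal2)"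
    using XZ.integrable_fst'[OF i] by simp
qed

lemma integrable_out_density: "integrable lborel (out_density P)"
  using integrable_out_density_times[of "\<lambda>_. 1"] growth_ge_1 by simp

lemma integral_out_density: "(\<integral>y. out_density P y \<partial>lborel) = 1"
  using integral_out_density_times[of "\<lambda>_. 1"] growth_ge_1
  by (simp add: prob_space[simplified] std_normal2.prob_space[simplified])

section \<open>Mutual information as mean cross-entropy minus noise entropy\<close>

lemma integrable_ln_gauss2: "integrable std_normal2 (\<lambda>z. ln (gauss2 z))"
  using integrable_std_normal2_norm_power2 by (simp add: gauss2_eq ln_div)

text \<open>I(X; Y) is the mean of ln (gauss2 (Y - X) / f(Y)) with Y - X = Z, so the logarithm
  splits; the second term is -h(Z), the same for every input.\<close>

lemma gaussian_mutual_information_eq: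
  "gaussian_mutual_information P
     = (\<integral>x. cross_info P x \<partial>P) + (\<integral>z. ln (gauss2 z) \<partial>std_normal2)"
proof -
  let ?M = "P \<Otimes>\<^sub>M std_normal2"
  interpret MI: information_space ?M "exp 1"
    by unfold_locales simp
  let ?X = "\<lambda>(x :: real \<times> real, z :: real \<times> real). x" and ?Y = "\<lambda>(x :: real \<times> real, z). x + z"
  \<comment> \<open>Relative to \<open>P\<close> itself the input has constant density 1.\<close>
  have X: "distributed ?M P ?X (\<lambda>_. ennreal 1)"
    using std_normal2.distr_pair_fst[of P]
    by (auto simp: distributed_def density_1 split_beta')
  have J: "distributed ?M (P \<Otimes>\<^sub>M lborel) (\<lambda>w. (?X w, ?Y w))
      (\<lambda>p. ennreal (gauss2 (snd p - fst p)))"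
    using distributed_joint by (simp add: split_beta')
  \<comment> \<open>Mutual information sees its two target measures only through their
    sigma-algebras, so \<open>P\<close> and \<open>lborel\<close> may replace
    \<open>borel\<close>.\<close>
  have "gaussian_mutual_information P = prob_space.mutual_information ?M (exp 1) P lborel ?X ?Y"
  proof -
    have "distr ?M borel ?X = distr ?M P ?X" "distr ?M borel ?Y = distr ?M lborel ?Y"
      "distr ?M (borel \<Otimes>\<^sub>M borel) (\<lambda>w. (?X w, ?Y w)) = distr ?M (P \<Otimes>\<^sub>M lborel) (\<lambda>w. (?X w, ?Y w))"
      by (auto intro!: distr_cong sets_pair_measure_cong simp: sets_P)
    then show ?thesis
      unfolding gaussian_mutual_information_def XZ.mutual_information_def by simp
  qed
  also have "\<dots> = (\<integral>p. gauss2 (snd p - fst p) * log (exp 1)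
      (gauss2 (snd p - fst p) / (1 * out_density P (snd p))) \<partial>(P \<Otimes>\<^sub>M lborel))"
    by (rule MI.mutual_information_distr[OF _ _ X _ distributed_output _ J])
       (auto simp: out_density_pos gauss2_pos less_imp_le sigma_finite_lborel
          intro: prob_space_imp_sigma_finite prob_space_axioms)
  \<comment> \<open>Back on the product space, the argument of \<open>gauss2\<close> is the noise
    itself.\<close>
  also have "\<dots> = (\<integral>w. log (exp 1) (gauss2 (snd (?X w, ?Y w) - fst (?X w, ?Y w))
      / (1 * out_density P (snd (?X w, ?Y w)))) \<partial>?M)"
    by (rule distributed_integral[OF J]) (auto simp: gauss2_pos less_imp_le)
  also have "\<dots> = (\<integral>w. surprisal P (fst w + snd w) + ln (gauss2 (snd w)) \<partial>?M)"
    by (rule Bochner_Integration.integral_cong)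
       (simp_all add: split_beta' log_def surprisal_def ln_div gauss2_pos out_density_pos
         less_imp_neq[OF gauss2_pos, symmetric] less_imp_neq[OF out_density_pos, symmetric]
         del: split_paired_All)
  also have "\<dots> = (\<integral>x. \<integral>z. surprisal P (x + z) + ln (gauss2 z) \<partial>std_normal2 \<partial>P)"
  proof -
    have "integrable ?M (\<lambda>w. surprisal P (fst w + snd w))"
      using integrable_shift_of_growth[OF _ abs_surprisal_le] by (simp add: split_beta')
    moreover have "integrable ?M (\<lambda>w. 0 + ln (gauss2 (snd w)))"
      by (intro integrable_pair_fst_plus_snd prob_space_axioms std_normal2.prob_space_axioms
          integrable_ln_gauss2) simp
    ultimately show ?thesis
      by (subst XZ.integral_fst'[symmetric]) auto
  qed
  also have "\<dots> = (\<integral>x. cross_info P x + (\<integral>z. ln (gauss2 z) \<partial>std_normal2) \<partial>P)"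
    by (simp add: cross_info_def integrable_surprisal_shift integrable_ln_gauss2)
  also have "\<dots> = (\<integral>x. cross_info P x \<partial>P) + (\<integral>z. ln (gauss2 z) \<partial>std_normal2)"
    using integrable_integral_shift[OF _ abs_surprisal_le]
    by (simp add: cross_info_def prob_space[simplified])
  finally show ?thesis .
qed

end

text \<open>Gibbs' inequality: the right side minus the left is the relative entropy of the two
  output densities.\<close>

lemma integral_cross_info_le:
  assumes "bounded_input P" "bounded_input Q"
  shows "(\<integral>x. cross_info P x \<partial>P) \<le> (\<integral>x. cross_info Q x \<partial>P)"
proof -
  interpret P: bounded_input P by fact
  interpret Q: bounded_input Q by fact
  let ?p = "out_density P" and ?q = "out_density Q"
  note iP = P.integrable_out_density_times[OF _ P.abs_surprisal_le]
  note iQ = P.integrable_out_density_times[OF _ Q.abs_surprisal_le]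
  \<comment> \<open>Pointwise this is \<open>ln r \<le> r - 1\<close> at
    \<open>r = ?q y / ?p y\<close>, multiplied by \<open>?p y\<close>; the left side is 0 because
    both densities have mass 1.\<close>
  have "(\<integral>y. ?p y - ?q y \<partial>lborel) \<le> (\<integral>y. ?p y * surprisal Q y - ?p y * surprisal P y \<partial>lborel)"
  proof (rule integral_mono)
    fix y
    have "ln (?q y / ?p y) \<le> ?q y / ?p y - 1"
      by (rule ln_le_minus_one) (simp add: P.out_density_pos Q.out_density_pos)
    then have "?p y * (ln (?q y) - ln (?p y)) \<le> ?p y * (?q y / ?p y - 1)"
      using P.out_density_pos[of y] Q.out_density_pos[of y]
      by (intro mult_left_mono) (auto simp: ln_div less_imp_le)
    then show "?p y - ?q y \<le> ?p y * surprisal Q y - ?p y * surprisal P y"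
      using P.out_density_pos[of y] by (simp add: surprisal_def algebra_simps)
  qed (use iP iQ P.integrable_out_density Q.integrable_out_density in auto)
  then have "0 \<le> (\<integral>y. ?p y * surprisal Q y \<partial>lborel) - (\<integral>y. ?p y * surprisal P y \<partial>lborel)"
    using iP iQ P.integrable_out_density Q.integrable_out_density
    by (simp add: P.integral_out_density Q.integral_out_density)
  then show ?thesis
    by (simp add: cross_info_def P.integral_out_density_times[OF _ P.abs_surprisal_le]
        P.integral_out_density_times[OF _ Q.abs_surprisal_le])
qed


section \<open>Contamination by a point mass\<close>

text \<open>For \<open>t\<close> in [0, 1], the mixture of \<open>P\<close> and the point mass at
  \<open>q\<close> with weights \<open>1 - t\<close> and \<open>t\<close>, realised by a biased coin
  so that results on product and image measures apply.\<close>

definition contaminate :: "(real \<times> real) measure \<Rightarrow> real \<times> real \<Rightarrow> real \<Rightarrow> (real \<times> real) measure" where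
  "contaminate P q t =
     distr (measure_pmf (bernoulli_pmf t) \<Otimes>\<^sub>M P) borel (\<lambda>(b, x). if b then q else x)"

context bounded_input
begin

lemma measurable_contaminate [measurable]:
  "(\<lambda>(b, x). if b then q else x) \<in> measurable (measure_pmf (bernoulli_pmf t) \<Otimes>\<^sub>M P) borel"
  by measurable

text \<open>Serves both the norm bound and membership in the ellipse: contamination at an admissible
  point keeps the input admissible.\<close>

lemma AE_contaminate:
  assumes "{x. R x} \<in> sets borel" "AE x in P. R x" "R q"
  shows "AE x in contaminate P q t. R x"
proof -
  interpret BP: pair_prob_space "measure_pmf (bernoulli_pmf t)" P ..
  have [measurable]: "Measurable.pred borel R"
    using assms(1) by (simp add: pred_def)
  have "AE w in measure_pmf (bernoulli_pmf t) \<Otimes>\<^sub>M P. R (case w of (b, x) \<Rightarrow> if b then q else x)"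
    by (rule BP.AE_pair_measure) (use assms(2,3) in auto)
  then show ?thesis
    unfolding contaminate_def by (subst AE_distr_iff) (auto simp: assms(1))
qed

lemma bounded_input_contaminate:
  assumes "(norm q)\<^sup>2 \<le> 2"
  shows "bounded_input (contaminate P q t)"
proof -
  interpret BP: pair_prob_space "measure_pmf (bernoulli_pmf t)" P ..
  interpret Q: prob_space "contaminate P q t"
    unfolding contaminate_def by (rule BP.prob_space_distr) measurable
  show ?thesis
    by unfold_locales (auto intro!: AE_contaminate AE_norm_le assms simp: contaminate_def)
qed

lemma integral_contaminate:
  fixes g :: "real \<times> real \<Rightarrow> real"
  assumes [measurable]: "g \<in> borel_measurable borel" and g: "integrable P g" and t: "0 \<le> t" "t \<le> 1"
  shows "(\<integral>x. g x \<partial>contaminate P q t) = t * g q + (1 - t) * (\<integral>x. g x \<partial>P)"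
proof -
  let ?B = "measure_pmf (bernoulli_pmf t)"
  interpret BP: pair_prob_space ?B P ..
  have *: "integrable P (\<lambda>x. g (if b then q else x))" for b
    by (cases b) (simp_all add: g)
  have "integrable (?B \<Otimes>\<^sub>M P) (\<lambda>(b, x). g (if b then q else x))"
    by (rule BP.Fubini_integrable)
       (auto intro!: integrable_measure_pmf_finite *)
  from BP.integral_fst'[OF this]
  have "(\<integral>b. \<integral>x. g (if b then q else x) \<partial>P \<partial>?B)
      = (\<integral>(b, x). g (if b then q else x) \<partial>(?B \<Otimes>\<^sub>M P))"
    by (simp only: prod.case)
  then have "(\<integral>b. \<integral>x. g (if b then q else x) \<partial>P \<partial>?B) = (\<integral>x. g x \<partial>contaminate P q t)"
    unfolding contaminate_def by (subst integral_distr) (auto simp: split_beta' cong: if_cong)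
  then show ?thesis
    using t by (simp add: prob_space[simplified] mult.commute)
qed

lemma out_density_contaminate:
  assumes "0 \<le> t" "t \<le> 1"
  shows "out_density (contaminate P q t) y = t * gauss2 (y - q) + (1 - t) * out_density P y"
  unfolding out_density_def
  by (rule integral_contaminate) (auto simp: integrable_gauss2_diff assms)

lemma borel_measurable_cross_info [measurable]: "cross_info P \<in> borel_measurable borel"
  unfolding cross_info_def[abs_def] by measurable

text \<open>With Q the contaminated input, optimality bounds the Q-mean of
  \<open>cross_info Q\<close>, and Gibbs' inequality bounds its P-mean from below. Hence
  \<open>cross_info Q q \<le> ?h\<close> for each \<open>t\<close>, and \<open>t\<close> tends to
  0.\<close>

lemma cross_info_le_of_optimal:
  assumes q: "(norm q)\<^sup>2 \<le> 2"
    and opt: "\<And>t. 0 < t \<Longrightarrow> t \<le> 1 \<Longrightarrow>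
      gaussian_mutual_information (contaminate P q t) \<le> gaussian_mutual_information P"
  shows "cross_info P q \<le> (\<integral>x. cross_info P x \<partial>P)" (is "_ \<le> ?h")
proof -
  have le: "cross_info (contaminate P q t) q \<le> ?h" if t: "0 < t" "t \<le> 1" for t
  proof -
    let ?Q = "contaminate P q t"
    interpret Q: bounded_input ?Q by (rule bounded_input_contaminate[OF q])
    have i: "integrable P (cross_info ?Q)"
      using integrable_integral_shift[OF _ Q.abs_surprisal_le] by (simp add: cross_info_def[abs_def])
    \<comment> \<open>The noise entropy cancels, and the mean under the mixture splits into its two
      parts.\<close>
    have "t * cross_info ?Q q + (1 - t) * (\<integral>x. cross_info ?Q x \<partial>P) \<le> ?h"
      using opt[OF t] t integral_contaminate[OF _ i, of t q]
      by (simp add: gaussian_mutual_information_eq Q.gaussian_mutual_information_eq)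
    moreover have "(1 - t) * ?h \<le> (1 - t) * (\<integral>x. cross_info ?Q x \<partial>P)"
      using t integral_cross_info_le[OF bounded_input_axioms Q.bounded_input_axioms]
      by (intro mult_left_mono) auto
    ultimately have "t * cross_info ?Q q \<le> t * ?h"
      by (simp add: algebra_simps)
    then show ?thesis using t by simp
  qed
  define t where "t n = inverse (real (Suc n))" for n
  have t: "0 < t n" "t n \<le> 1" for n
    by (auto simp: t_def field_simps)
  have t0: "t \<longlonglongrightarrow> 0"
    unfolding t_def by (rule LIMSEQ_inverse_real_of_nat)
  \<comment> \<open>Dominated convergence: the output density is affine in \<open>t\<close>, and
    \<open>growth\<close> dominates the surprisals of all contaminations at once.\<close>
  have "(\<lambda>n. cross_info (contaminate P q (t n)) q) \<longlonglongrightarrow> cross_info P q"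
    unfolding cross_info_def
  proof (rule integral_dominated_convergence)
    show "integrable std_normal2 (\<lambda>z. growth (q + z))"
      by (rule integrable_growth_shift)
    show "(\<lambda>z. surprisal (contaminate P q (t n)) (q + z)) \<in> borel_measurable std_normal2" for n
    proof -
      interpret Q: bounded_input "contaminate P q (t n)" by (rule bounded_input_contaminate[OF q])
      show ?thesis by measurable
    qed
    show "AE z in std_normal2. norm (surprisal (contaminate P q (t n)) (q + z)) \<le> growth (q + z)" for n
      using bounded_input.abs_surprisal_le[OF bounded_input_contaminate[OF q]] by (intro AE_I2) simp
    show "AE z in std_normal2. (\<lambda>n. surprisal (contaminate P q (t n)) (q + z)) \<longlonglongrightarrow> surprisal P (q + z)"
    proof (rule AE_I2)
      fix z
      have "(\<lambda>n. t n * gauss2 (q + z - q) + (1 - t n) * out_density P (q + z))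
          \<longlonglongrightarrow> 0 * gauss2 (q + z - q) + (1 - 0) * out_density P (q + z)"
        by (intro tendsto_intros t0)
      then show "(\<lambda>n. surprisal (contaminate P q (t n)) (q + z)) \<longlonglongrightarrow> surprisal P (q + z)"
        unfolding surprisal_def using t out_density_pos[of "q + z"]
        by (intro tendsto_intros) (auto simp: out_density_contaminate less_imp_le)
    qed
  qed measurable
  then show ?thesis
    by (rule LIMSEQ_le_const2) (use le t in auto)
qed

end

section \<open>Strict discrete subharmonicity of the surprisal\<close>

text \<open>Hoeffding's lemma for a fair random sign, whose moment generating function is
  \<open>cosh\<close>.\<close>

lemma cosh_le_exp: "cosh s \<le> exp (s\<^sup>2 / 2)" for s :: real
proof -
  have *: "cosh s \<le> exp (s\<^sup>2 / 2)" if "0 \<le> s" for s :: real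
  proof -
    \<comment> \<open>The instance has step \<open>2 * s\<close> and probability
      \<open>1 / 2\<close>; the argument of \<open>ln\<close> equals \<open>exp s * cosh s\<close>,
      and the linear term cancels \<open>exp s\<close>.\<close>
    have "- (2 * s) * (1 / 2) + ln (1 + 1 / 2 * (exp (2 * s) - 1)) \<le> (2 * s)\<^sup>2 / 8"
      by (rule Hoeffdings_lemma_aux) (use that in auto)
    then have "ln (1 + 1 / 2 * (exp (2 * s) - 1)) \<le> s\<^sup>2 / 2 + s"
      by (simp add: power2_eq_square)
    moreover have "1 + 1 / 2 * (exp (2 * s) - 1) = exp s * cosh s"
      by (simp add: cosh_def field_simps flip: exp_add)
    ultimately have "ln (cosh s) \<le> s\<^sup>2 / 2"
      by (simp add: ln_mult)
    then show ?thesis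
      by (metis cosh_real_pos exp_le_cancel_iff exp_ln)
  qed
  show ?thesis using *[of s] *[of "- s"] by (cases "0 \<le> s") auto
qed

text \<open>Strictness comes from the non-strict bound at \<open>s / 2\<close> together with \<open>2 e - 1 < e\<^sup>2\<close>.\<close>

lemma cosh_less_exp: "cosh s < exp (s\<^sup>2 / 2)" if "s \<noteq> 0" for s :: real
proof -
  define e where "e = exp (s\<^sup>2 / 4)"
  have e: "e\<^sup>2 = exp (s\<^sup>2 / 2)"
    by (simp add: e_def flip: exp_double)
  have c: "cosh s = 2 * (cosh (s / 2))\<^sup>2 - 1"
    using cosh_double_cosh[of "s / 2"] by simp
  have "(cosh (s / 2))\<^sup>2 \<le> (exp ((s / 2)\<^sup>2 / 2))\<^sup>2"
    by (rule power_mono[OF cosh_le_exp]) simp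
  also have "\<dots> = e"
    by (simp add: e_def power2_eq_square flip: exp_add)
  finally have "cosh s \<le> 2 * e - 1" using c by simp
  also have "\<dots> < e\<^sup>2"
  proof -
    have "e \<noteq> 1" using that by (simp add: e_def)
    then have "0 < (e - 1)\<^sup>2" by simp
    then show ?thesis by (simp add: power2_eq_square algebra_simps)
  qed
  finally show ?thesis using e by simp
qed

text \<open>Sum-to-product turns the sum into \<open>2 * (cosh u * cosh v)\<close>, where u^2 + v^2
  = (a^2 + b^2) / 2 <= c; the one-variable bounds then multiply.\<close>

lemma cosh_add_cosh_less:
  fixes a b c :: real
  assumes "a\<^sup>2 + b\<^sup>2 \<le> 2 * c" "0 < c"
  shows "cosh a + cosh b < 2 * exp (c / 2)"
proof -
  define u v where "u = (a + b) / 2" and "v = (a - b) / 2"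
  have uv: "a = u + v" "b = u - v" by (auto simp: u_def v_def field_simps)
  have le: "u\<^sup>2 / 2 + v\<^sup>2 / 2 \<le> c / 2"
    using assms(1) unfolding uv by (simp add: power2_eq_square algebra_simps)
  have "cosh a + cosh b = 2 * (cosh u * cosh v)"
    unfolding uv by (simp add: cosh_add cosh_diff)
  also have "cosh u * cosh v < exp (c / 2)"
  \<comment> \<open>If both vanish, strictness comes from \<open>0 < c\<close>; otherwise one strict
    factor suffices.\<close>
  proof (cases "u = 0 \<and> v = 0")
    case True
    then show ?thesis using assms(2) by simp
  next
    case False
    have "cosh u * cosh v < exp (u\<^sup>2 / 2) * exp (v\<^sup>2 / 2)"
    proof (cases "u = 0")
      case True
      then show ?thesis using False cosh_less_exp[of v] by simp
    next
      case False
      then show ?thesis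
        by (intro mult_less_le_imp_less cosh_less_exp cosh_le_exp) (auto simp: cosh_real_pos)
    qed
    also have "\<dots> \<le> exp (c / 2)"
      using le by (simp flip: exp_add)
    finally show ?thesis .
  qed
  finally show ?thesis by simp
qed

section \<open>The partition function and the four-point inequality\<close>

lemma exp_inner_eq_gauss2:
  "exp (y \<bullet> x - (norm x)\<^sup>2 / 2) = 2 * pi * exp ((norm y)\<^sup>2 / 2) * gauss2 (y - x)"
  unfolding gauss2_eq
  by (simp add: power2_norm_eq_inner algebra_simps inner_commute flip: exp_add) (simp add: field_simps)

text \<open>The Laplace transform of the measure with density exp (- |x|^2 / 2) relative to
  \<open>P\<close>; it normalises the conditional law of X given Y = y.\<close>

definition partition_fun :: "(real \<times> real) measure \<Rightarrow> real \<times> real \<Rightarrow> real" where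
  "partition_fun P y = (\<integral>x. exp (y \<bullet> x - (norm x)\<^sup>2 / 2) \<partial>P)"

context bounded_input
begin

lemma integrable_partition_fun: "integrable P (\<lambda>x. exp (y \<bullet> x - (norm x)\<^sup>2 / 2))"
  by (simp add: exp_inner_eq_gauss2 integrable_gauss2_diff)

lemma partition_fun_eq: "partition_fun P y = 2 * pi * exp ((norm y)\<^sup>2 / 2) * out_density P y"
  by (simp add: partition_fun_def out_density_def exp_inner_eq_gauss2)

lemma partition_fun_pos: "0 < partition_fun P y"
  by (simp add: partition_fun_eq out_density_pos)

text \<open>Separates the two contributions to the Laplacian: the quadratic term gives 2, and
  \<open>ln (partition_fun P y)\<close> gives the trace of the conditional covariance.\<close>

lemma surprisal_eq: "surprisal P y = (norm y)\<^sup>2 / 2 + ln (2 * pi) - ln (partition_fun P y)"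
  using out_density_pos[of y] by (simp add: surprisal_def partition_fun_eq ln_mult)

text \<open>Shifting \<open>y\<close> by d along an axis, in either direction, multiplies the
  integrand by exp (d x_j) or exp (- d x_j). The four factors add up to twice a sum of two
  \<open>cosh\<close> values, which is bounded for almost every \<open>x\<close>.\<close>

lemma sum_partition_fun_less:
  assumes "0 < d"
  shows "partition_fun P (y + (d, 0)) + partition_fun P (y + (- d, 0))
    + partition_fun P (y + (0, d)) + partition_fun P (y + (0, - d))
    < 4 * exp (d\<^sup>2 / 2) * partition_fun P y" (is "?L < ?R")
proof -
  let ?w = "\<lambda>y x. exp (y \<bullet> x - (norm x)\<^sup>2 / 2)"
  have "?L = (\<integral>x. ?w (y + (d, 0)) x + ?w (y + (- d, 0)) x + ?w (y + (0, d)) x + ?w (y + (0, - d)) x \<partial>P)"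
    unfolding partition_fun_def using integrable_partition_fun by simp
  also have "\<dots> < (\<integral>x. 4 * exp (d\<^sup>2 / 2) * ?w y x \<partial>P)"
  proof (rule integral_less_AE_space)
    show "AE x in P. ?w (y + (d, 0)) x + ?w (y + (- d, 0)) x + ?w (y + (0, d)) x + ?w (y + (0, - d)) x
        < 4 * exp (d\<^sup>2 / 2) * ?w y x"
      using AE_norm_le
    proof eventually_elim
      case (elim x)
      \<comment> \<open>Here |x|^2 <= 2 enters: it is exactly the hypothesis of
        \<open>cosh_add_cosh_less\<close> with \<open>c\<close> the square of
        \<open>d\<close>.\<close>
      have "(d * fst x)\<^sup>2 + (d * snd x)\<^sup>2 = d\<^sup>2 * (norm x)\<^sup>2"
        by (simp add: norm_prod_power2 power_mult_distrib algebra_simps)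
      also have "\<dots> \<le> d\<^sup>2 * 2" using elim by (intro mult_left_mono) auto
      finally have cosh: "cosh (d * fst x) + cosh (d * snd x) < 2 * exp (d\<^sup>2 / 2)"
        by (intro cosh_add_cosh_less) (use assms in auto)
      have "?w (y + (d, 0)) x + ?w (y + (- d, 0)) x + ?w (y + (0, d)) x + ?w (y + (0, - d)) x
          = ?w y x * (2 * (cosh (d * fst x) + cosh (d * snd x)))"
        by (cases x, cases y)
           (simp add: cosh_def inner_add_left algebra_simps flip: exp_add)
      also have "\<dots> < ?w y x * (4 * exp (d\<^sup>2 / 2))"
        using cosh by (intro mult_strict_left_mono) auto
      finally show ?case by (simp only: mult_ac)
    qed
  qed (use integrable_partition_fun emeasure_space_1 in auto)
  also have "\<dots> = ?R" by (simp add: partition_fun_def)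
  finally show ?thesis .
qed

text \<open>Concavity of \<open>ln\<close> carries the bound on the sum of partition functions over
  to the sum of their logarithms.\<close>

lemma surprisal_less_sum:
  assumes "0 < d"
  shows "4 * surprisal P y < surprisal P (y + (d, 0)) + surprisal P (y + (- d, 0))
    + surprisal P (y + (0, d)) + surprisal P (y + (0, - d))"
proof -
  \<comment> \<open>The point of tangency is the upper bound for the mean of the four values; the
    d^2 / 2 in \<open>ln v\<close> matches the mean increase of |y|^2 / 2.\<close>
  define v where "v = exp (d\<^sup>2 / 2) * partition_fun P y"
  have v: "0 < v" by (simp add: v_def partition_fun_pos)
  have lnv: "ln v = d\<^sup>2 / 2 + ln (partition_fun P y)"
    using partition_fun_pos[of y] by (simp add: v_def ln_mult)
  have tangent: "ln (partition_fun P u) \<le> ln v + partition_fun P u / v - 1" for u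
  proof -
    have "ln (partition_fun P u / v) \<le> partition_fun P u / v - 1"
      by (rule ln_le_minus_one) (simp add: v partition_fun_pos)
    then show ?thesis using v partition_fun_pos[of u] by (simp add: ln_div)
  qed
  have "(partition_fun P (y + (d, 0)) + partition_fun P (y + (- d, 0))
    + partition_fun P (y + (0, d)) + partition_fun P (y + (0, - d))) / v < 4"
    using sum_partition_fun_less[OF assms, of y] v by (simp add: v_def field_simps)
  then have "ln (partition_fun P (y + (d, 0))) + ln (partition_fun P (y + (- d, 0)))
    + ln (partition_fun P (y + (0, d))) + ln (partition_fun P (y + (0, - d))) < 4 * ln v"
    using tangent[of "y + (d, 0)"] tangent[of "y + (- d, 0)"]
      tangent[of "y + (0, d)"] tangent[of "y + (0, - d)"]
    by (simp add: add_divide_distrib)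
  moreover have "(norm (y + (d, 0)))\<^sup>2 + (norm (y + (- d, 0)))\<^sup>2
    + (norm (y + (0, d)))\<^sup>2 + (norm (y + (0, - d)))\<^sup>2 = 4 * (norm y)\<^sup>2 + 4 * d\<^sup>2"
    by (simp only: norm_prod_power2) (simp add: power2_eq_square algebra_simps)
  ultimately show ?thesis
    unfolding surprisal_eq lnv by (simp add: field_simps)
qed

lemma cross_info_less_sum:
  assumes "0 < d"
  shows "4 * cross_info P x < cross_info P (x + (d, 0)) + cross_info P (x + (- d, 0))
    + cross_info P (x + (0, d)) + cross_info P (x + (0, - d))"
proof -
  have "(\<integral>z. 4 * surprisal P (x + z) \<partial>std_normal2)
    < (\<integral>z. surprisal P (x + (d, 0) + z) + surprisal P (x + (- d, 0) + z)
        + surprisal P (x + (0, d) + z) + surprisal P (x + (0, - d) + z) \<partial>std_normal2)"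
  proof (rule std_normal2.integral_less_AE_space)
    show "AE z in std_normal2. 4 * surprisal P (x + z)
      < surprisal P (x + (d, 0) + z) + surprisal P (x + (- d, 0) + z)
        + surprisal P (x + (0, d) + z) + surprisal P (x + (0, - d) + z)"
      using surprisal_less_sum[OF assms, of "x + z" for z] by (intro AE_I2) (simp add: add_ac)
  qed (use integrable_surprisal_shift std_normal2.emeasure_space_1 in auto)
  then show ?thesis
    using integrable_surprisal_shift by (simp add: cross_info_def)
qed

end

section \<open>The ellipse\<close>

lemma closed_ellipse: "closed (ellipse rp rm)"
proof -
  \<comment> \<open>Degenerate radii contribute a closed coordinate axis as a further factor of the
    intersection.\<close>
  have "ellipse rp rm = {x. (fst x)\<^sup>2 / rp\<^sup>2 + (snd x)\<^sup>2 / rm\<^sup>2 \<le> 1}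
      \<inter> (if rp = 0 then {x. fst x = 0} else UNIV) \<inter> (if rm = 0 then {x. snd x = 0} else UNIV)"
    by (auto simp: ellipse_def)
  moreover have "closed {x :: real \<times> real. (fst x)\<^sup>2 / rp\<^sup>2 + (snd x)\<^sup>2 / rm\<^sup>2 \<le> 1}"
    unfolding divide_inverse by (intro closed_Collect_le continuous_intros)
  moreover have "closed {x :: real \<times> real. fst x = 0}" "closed {x :: real \<times> real. snd x = 0}"
    by (intro closed_Collect_eq continuous_intros)+
  ultimately show ?thesis by (simp add: closed_Int)
qed

text \<open>Lengthening the minor semi-axis to \<open>rp\<close> gives a disc that contains the
  ellipse; for \<open>rm = 0\<close> the second coordinate vanishes.\<close>

lemma norm_le_of_mem_ellipse:
  assumes "x \<in> ellipse rp rm" "0 \<le> rm" "rm \<le> rp"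
  shows "(norm x)\<^sup>2 \<le> rp\<^sup>2"
proof (cases "rp = 0")
  case True
  then show ?thesis using assms by (auto simp: ellipse_def norm_prod_power2)
next
  case False
  have "(snd x)\<^sup>2 / rp\<^sup>2 \<le> (snd x)\<^sup>2 / rm\<^sup>2"
  proof (cases "rm = 0")
    case True
    then show ?thesis using assms by (auto simp: ellipse_def)
  next
    case False
    then show ?thesis using assms by (intro divide_left_mono power_mono) auto
  qed
  then have "(fst x)\<^sup>2 / rp\<^sup>2 + (snd x)\<^sup>2 / rp\<^sup>2 \<le> 1"
    using assms(1) unfolding ellipse_def by (simp add: split_beta')
  then show ?thesis
    using False by (simp add: norm_prod_power2 divide_simps flip: add_divide_distrib)
qed

section \<open>The support of an optimal input\<close>

theorem theorem1:
  fixes rp rm :: real and P :: "(real \<times> real) measure"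
  assumes "0 \<le> rm" and "rm \<le> rp" and "rp \<le> sqrt 2"
    and "capacity_achieving rp rm P"
  shows "measure_supp P \<subseteq> frontier (ellipse rp rm)"
proof -
  let ?E = "ellipse rp rm"
  have E2: "(norm x)\<^sup>2 \<le> 2" if "x \<in> ?E" for x
  proof -
    have "rp\<^sup>2 \<le> (sqrt 2)\<^sup>2" by (rule power_mono) (use assms in auto)
    then show ?thesis using norm_le_of_mem_ellipse[OF that assms(1,2)] by simp
  qed
  have P: "prob_space P" "sets P = sets borel" and PE: "AE x in P. x \<in> ?E"
    and max: "\<And>Q. Q \<in> input_distributions rp rm \<Longrightarrow>
      gaussian_mutual_information Q \<le> gaussian_mutual_information P"
    using assms(4) SUP_upper[where A = "input_distributions rp rm"
        and f = "\<lambda>Q. ereal (gaussian_mutual_information Q)"]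
    by (auto simp: capacity_achieving_def input_distributions_def capacity_def simp flip: ereal_less_eq(3))
  interpret bounded_input P
  proof (intro bounded_input.intro bounded_input_axioms.intro P)
    show "AE x in P. (norm x)\<^sup>2 \<le> 2"
      using PE by eventually_elim (rule E2)
  qed
  let ?h = "\<integral>x. cross_info P x \<partial>P"
  \<comment> \<open>The ellipse is closed, hence measurable, so contamination at one of its points
    gives an admissible competitor.\<close>
  have le: "cross_info P q \<le> ?h" if "q \<in> ?E" for q
  proof (rule cross_info_le_of_optimal[OF E2[OF that]])
    fix t :: real
    interpret Q: bounded_input "contaminate P q t"
      by (rule bounded_input_contaminate[OF E2[OF that]])
    have "AE x in contaminate P q t. x \<in> ?E"
      by (rule AE_contaminate) (use PE that closed_ellipse in auto)
    then show "gaussian_mutual_information (contaminate P q t) \<le> gaussian_mutual_information P"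
      by (intro max) (simp add: input_distributions_def Q.prob_space_axioms Q.sets_P)
  qed
  \<comment> \<open>A small ball around \<open>x\<close> contains the four axis neighbours, each
    with value at most \<open>?h\<close>. For \<open>rm = 0\<close> the interior is empty and the
    frontier is the whole ellipse.\<close>
  have less: "cross_info P x < ?h" if x: "x \<in> interior ?E" for x
  proof -
    obtain d where d: "0 < d" "cball x d \<subseteq> ?E"
      using x mem_interior_cball by metis
    have "x + (d, 0) \<in> ?E" "x + (- d, 0) \<in> ?E" "x + (0, d) \<in> ?E" "x + (0, - d) \<in> ?E"
      by (rule subsetD[OF d(2)], use d(1) in \<open>simp add: dist_norm\<close>)+
    from this[THEN le] show ?thesis
      using cross_info_less_sum[OF d(1), of x] by simp
  qed
  have i: "integrable P (cross_info P)"
    using integrable_integral_shift[OF _ abs_surprisal_le] by (simp add: cross_info_def[abs_def])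
  have interior_null: "emeasure P (interior ?E) = 0"
  proof (rule ccontr)
    assume pos: "emeasure P (interior ?E) \<noteq> 0"
    \<comment> \<open>Mass in the interior would put the mean of \<open>cross_info P\<close>
      strictly below itself.\<close>
    have "?h < (\<integral>x. ?h \<partial>P)"
    proof (rule integral_less_AE[OF i integrable_const])
      show "AE x in P. cross_info P x \<le> ?h"
        using PE by eventually_elim (rule le)
      show "AE x in P. x \<in> interior ?E \<longrightarrow> cross_info P x \<noteq> ?h"
        by (intro AE_I2 impI less_imp_neq less)
    qed (use pos in \<open>auto simp: sets_P\<close>)
    then show False by (simp add: prob_space[simplified])
  qed
  show ?thesis
  proof
    fix x assume x: "x \<in> measure_supp P"
    \<comment> \<open>The support misses every open null set: first the complement of the closed
      ellipse, then its interior.\<close>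
    have "emeasure P (- ?E) = 0"
      using PE by (subst (asm) AE_iff_measurable[of "- ?E"]) (auto simp: sets_P closed_ellipse)
    with x closed_ellipse[of rp rm] have "x \<in> ?E"
      by (auto simp: measure_supp_def open_Compl)
    moreover have "x \<notin> interior ?E"
      using x interior_null by (auto simp: measure_supp_def)
    ultimately show "x \<in> frontier ?E"
      by (simp add: frontier_def closed_ellipse closure_closed)
  qed
qed

end
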